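(* Let $P=\{p_1,p_2,p_3,p_4,p_5\}$ be a set of five points and let $\mathbf{X}$ be a function from the set of ordered quadruples of pairwise distinct elements of $P$ to $\mathbb{C}\setminus\{0,1\}$ whose restriction to every four-element subset of $P$ is a cross-ratio structure, and which satisfies the edge compatibility and face compatibility conditions (all defined in the context). Then the volume function $\mathcal{D}$ of $\mathbf{X}$ satisfies the 5-term relation $$\mathcal{D}([p_1,p_2,p_3,p_4])-\mathcal{D}([p_1,p_2,p_3,p_5])+\mathcal{D}([p_1,p_2,p_4,p_5])-\mathcal{D}([p_1,p_3,p_4,p_5])+\mathcal{D}([p_2,p_3,p_4,p_5])=0.$$
   Context: Cross-ratio structure: a cross-ratio structure on a set of four points is a function $\mathbf{X}$ from the set of its 24 orderings to $\mathbb{C}\setminus\{0,1\}$ such that for every ordering $(a,b,c,d)$ of the four points: (1) $\mathbf{X}(a,b,c,d)=\dfrac{1}{\mathbf{X}(a,b,d,c)}$, and (2) (similarity relations) $\mathbf{X}(a,b,c,d)=\dfrac{1}{1-\mathbf{X}(a,d,b,c)}$. Compatibility conditions for five points: write $(ijkl)=\mathbf{X}(p_i,p_j,p_k,p_l)$. For every $i,j,k,l,m$ with $\{i,j,k,l,m\}=\{1,2,3,4,5\}$: Edge compatibility: $(ijkl)=(ijkm)(ijml)$. Face compatibility: $(ijkl)(ljik)(kjli)=(imkl)(lmik)(kmli)$. Bloch-Wigner dilogarithm: $D(z)=\log|z|\,\arg(1-z)-\mathrm{Im}\int_0^z\frac{\log(1-t)}{t}\,dt$, which is well defined and real analytic on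 $\mathbb{C}\setminus\{0,1\}$ and extends continuously to $\mathbb{C}P^1$ by $D(0)=D(1)=D(\infty)=0$. Volume: for an ordered quadruple (simplex) $[q_1,q_2,q_3,q_4]$ of distinct points with cross-ratio structure $\mathbf{X}$, $$\mathcal{D}([q_1,q_2,q_3,q_4])=D(\mathbf{X}(q_1,q_2,q_3,q_4))+D(\mathbf{X}(q_2,q_1,q_4,q_3))+D(\mathbf{X}(q_3,q_4,q_1,q_2))+D(\mathbf{X}(q_4,q_3,q_2,q_1)).$$ *)

theory Defs
  imports "HOL-Complex_Analysis.Complex_Analysis"
    "HOL-Real_Asymp.Real_Asymp"
begin

text \<open>
  A function on ordered quadruples of distinct points is represented by a total curried function;
  its values at quadruples with a repeated point are never constrained or used.
\<close>

definition cross_ratio_structure :: "'a set \<Rightarrow> ('a \<Rightarrow> 'a \<Rightarrow> 'a \<Rightarrow> 'a \<Rightarrow> complex) \<Rightarrow> bool" where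
  "cross_ratio_structure S X \<longleftrightarrow>
     card S = 4 \<and>
     (\<forall>a b c d. distinct [a, b, c, d] \<and> {a, b, c, d} = S \<longrightarrow>
        X a b c d \<in> UNIV - {0, 1} \<and>
        X a b c d = 1 / X a b d c \<and>
        X a b c d = 1 / (1 - X a d b c))"

definition edge_compatible :: "(nat \<Rightarrow> 'a) \<Rightarrow> ('a \<Rightarrow> 'a \<Rightarrow> 'a \<Rightarrow> 'a \<Rightarrow> complex) \<Rightarrow> bool" where
  "edge_compatible p X \<longleftrightarrow>
     (\<forall>i j k l m. {i, j, k, l, m} = {1, 2, 3, 4, 5} \<longrightarrow>
        X (p i) (p j) (p k) (p l) = X (p i) (p j) (p k) (p m) * X (p i) (p j) (p m) (p l))"

definition face_compatible :: "(nat \<Rightarrow> 'a) \<Rightarrow> ('a \<Rightarrow> 'a \<Rightarrow> 'a \<Rightarrow> 'a \<Rightarrow> complex) \<Rightarrow> bool" where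
  "face_compatible p X \<longleftrightarrow>
     (\<forall>i j k l m. {i, j, k, l, m} = {1, 2, 3, 4, 5} \<longrightarrow>
        X (p i) (p j) (p k) (p l) * X (p l) (p j) (p i) (p k) * X (p k) (p j) (p l) (p i) =
        X (p i) (p m) (p k) (p l) * X (p l) (p m) (p i) (p k) * X (p k) (p m) (p l) (p i))"

text \<open>
  The Bloch-Wigner dilogarithm, with principal branches of the argument and the logarithm and
  the integral taken along the straight segment from \<open>0\<close> to \<open>z\<close>. On the slit
  plane without \<open>[1, \<infinity>)\<close> this is unambiguous. For real \<open>z > 1\<close> the segment runs along
  the branch cut of \<open>Ln (1 - t)\<close>, with a logarithmic (hence integrable) singularity at
  \<open>t = 1\<close>; both terms then equal \<open>pi * ln z\<close>, so the formula yields \<open>0\<close>, the value forced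
  by continuity (lemma \<open>bloch_wigner_of_real_gt_1\<close> below).
\<close>

definition bloch_wigner :: "complex \<Rightarrow> real" where
  "bloch_wigner z =
     ln (cmod z) * Arg (1 - z) - Im (contour_integral (linepath 0 z) (\<lambda>t. Ln (1 - t) / t))"

definition simplex_volume ::
  "('a \<Rightarrow> 'a \<Rightarrow> 'a \<Rightarrow> 'a \<Rightarrow> complex) \<Rightarrow> 'a \<Rightarrow> 'a \<Rightarrow> 'a \<Rightarrow> 'a \<Rightarrow> real" where
  "simplex_volume X q1 q2 q3 q4 =
     bloch_wigner (X q1 q2 q3 q4) + bloch_wigner (X q2 q1 q4 q3) +
     bloch_wigner (X q3 q4 q1 q2) + bloch_wigner (X q4 q3 q2 q1)"

lemma bloch_wigner_of_real_gt_1: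
  fixes r :: real
  assumes r: "r > 1"
  shows "bloch_wigner (of_real r) = 0"
proof -
  define s where "s = 1 / (2 * r)"
  have s: "0 < s" "s < 1 / r" "s \<le> 1" "1 / r < 1" "0 < 1 / r"
    using r by (auto simp: s_def field_simps)
  define a where "a x = ln \<bar>1 - x * r\<bar> / x" for x :: real
  define b where "b x = (if x \<le> 1 / r then 0 else pi / x)" for x :: real

  have a1: "a integrable_on {0..s}"
  proof (rule integrable_spike_finite[where S = "{0}"])
    have lim: "((\<lambda>x. ln (1 - x * r) / x) \<longlongrightarrow> -r) (at 0)"
    proof -
      have "((\<lambda>x. ln (1 - x * r)) has_real_derivative -r) (at 0)"
        by (auto intro!: derivative_eq_intros)
      thus ?thesis
        by (simp add: has_field_derivative_iff)
    qed
    have pos: "1 - x * r > 0" if "x \<in> {0..s}" for x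
    proof -
      have "x * r \<le> s * r" using that r by (intro mult_right_mono) auto
      also have "\<dots> < 1" using r by (simp add: s_def)
      finally show ?thesis by simp
    qed
    have "continuous (at x within {0..s}) (\<lambda>x. if x = 0 then -r else ln (1 - x * r) / x)"
      if "x \<in> {0..s}" for x
    proof (cases "x = 0")
      case True
      have "((\<lambda>x. if x = 0 then -r else ln (1 - x * r) / x) \<longlongrightarrow> -r) (at 0)"
        using lim by (rule Lim_transform_eventually) (auto simp: eventually_at_filter)
      hence "isCont (\<lambda>x. if x = 0 then -r else ln (1 - x * r) / x) 0"
        by (simp add: isCont_def)
      thus ?thesis using True continuous_at_imp_continuous_at_within by blast
    next
      case False
      have "isCont (\<lambda>x. ln (1 - x * r) / x) x"
        using False pos[OF that] by (auto intro!: continuous_intros)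
      moreover have "\<forall>\<^sub>F y in nhds x. (if y = 0 then -r else ln (1 - y * r) / y) = ln (1 - y * r) / y"
        using t1_space_nhds[OF False] by eventually_elim auto
      ultimately have "isCont (\<lambda>x. if x = 0 then -r else ln (1 - x * r) / x) x"
        by (subst isCont_cong) auto
      thus ?thesis using continuous_at_imp_continuous_at_within by blast
    qed
    thus "(\<lambda>x. if x = 0 then -r else ln (1 - x * r) / x) integrable_on {0..s}"
      by (intro integrable_continuous_interval) (auto simp: continuous_on_eq_continuous_within)
    show "a x = (if x = 0 then -r else ln (1 - x * r) / x)" if "x \<in> {0..s} - {0}" for x
      using pos[of x] that by (auto simp: a_def)
  qed auto

  have a2: "a integrable_on {s..1}"
  proof -
    define G where "G x = (x - 1 / r) * ln \<bar>1 - x * r\<bar> - (x - 1 / r)" for x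
    have xlnx: "continuous_on UNIV (\<lambda>x::real. x * ln \<bar>x\<bar>)"
    proof -
      have "isCont (\<lambda>x::real. x * ln \<bar>x\<bar>) x" for x
      proof (cases "x = 0")
        case True
        have "((\<lambda>x::real. x * ln \<bar>x\<bar>) \<longlongrightarrow> 0) (at_right 0)" "((\<lambda>x::real. x * ln \<bar>x\<bar>) \<longlongrightarrow> 0) (at_left 0)"
          by real_asymp+
        thus ?thesis using True by (simp add: isCont_def filterlim_split_at)
      qed (auto intro!: continuous_intros)
      thus ?thesis by (simp add: continuous_on_eq_continuous_at)
    qed
    have "continuous_on {s..1} (\<lambda>x. (1 - x * r) * ln \<bar>1 - x * r\<bar>)"
      by (rule continuous_on_compose2[OF xlnx]) (auto intro!: continuous_intros)
    hence "continuous_on {s..1} (\<lambda>x. -(1 / r) * ((1 - x * r) * ln \<bar>1 - x * r\<bar>) - (x - 1 / r))"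
      by (rule continuous_on_diff[OF continuous_on_mult_left]) (auto intro!: continuous_intros)
    also have "(\<lambda>x. -(1 / r) * ((1 - x * r) * ln \<bar>1 - x * r\<bar>) - (x - 1 / r)) = G"
      using r by (auto simp: G_def fun_eq_iff field_simps)
    finally have G: "continuous_on {s..1} G" .
    have G': "(G has_real_derivative ln \<bar>1 - x * r\<bar>) (at x)" if "x \<noteq> 1 / r" for x
    proof -
      have ne: "1 - x * r \<noteq> 0" using that r by (auto simp: field_simps)
      have "((\<lambda>x. ln \<bar>1 - x * r\<bar>) has_real_derivative -r / (1 - x * r)) (at x)"
      proof (cases "1 - x * r > 0")
        case True
        have "((\<lambda>x. ln (1 - x * r)) has_real_derivative -r / (1 - x * r)) (at x)"
          using True by (auto intro!: derivative_eq_intros simp: field_simps)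
        moreover have "open ((\<lambda>x. 1 - x * r) -` {0<..})"
          by (intro open_vimage) (auto intro!: continuous_intros)
        ultimately show ?thesis
          by (rule has_field_derivative_transform_within_open) (use True in auto)
      next
        case False
        hence "1 - x * r < 0" using ne by auto
        have "((\<lambda>x. ln (x * r - 1)) has_real_derivative -r / (1 - x * r)) (at x)"
          using \<open>1 - x * r < 0\<close> 
          by (auto intro!: derivative_eq_intros simp: divide_simps) (simp add: algebra_simps)
        moreover have "open ((\<lambda>x. 1 - x * r) -` {..<0})"
          by (intro open_vimage) (auto intro!: continuous_intros)
        ultimately show ?thesis
          by (rule has_field_derivative_transform_within_open) (use \<open>1 - x * r < 0\<close> in auto)
      qed
      moreover have "((\<lambda>x. x - 1 / r) has_real_derivative 1) (at x)"
        by (auto intro!: derivative_eq_intros)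
      ultimately have "(G has_real_derivative
          1 * ln \<bar>1 - x * r\<bar> + (-r / (1 - x * r)) * (x - 1 / r) - 1) (at x)"
        unfolding G_def by (intro DERIV_diff DERIV_mult)
      moreover have "(-r / (1 - x * r)) * (x - 1 / r) = 1"
        using ne r by (simp add: divide_simps) (simp add: algebra_simps)?
      ultimately show ?thesis by simp
    qed
    have "((\<lambda>x. ln \<bar>1 - x * r\<bar> / x - G x / x\<^sup>2) has_integral (G 1 / 1 - G s / s)) {s..1}"
    proof (rule fundamental_theorem_of_calculus_strong[where S = "{1 / r}" and f = "\<lambda>x. G x / x"])
      fix x assume x: "x \<in> {s..1} - {1 / r}"
      have "x \<noteq> 0" using x s by auto
      have "((\<lambda>x. G x / x) has_real_derivative ln \<bar>1 - x * r\<bar> / x - G x / x\<^sup>2) (at x)"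
        using G'[of x] x \<open>x \<noteq> 0\<close>
        by (auto intro!: derivative_eq_intros simp: field_simps power2_eq_square)
      thus "((\<lambda>x. G x / x) has_vector_derivative ln \<bar>1 - x * r\<bar> / x - G x / x\<^sup>2) (at x)"
        by (simp add: has_real_derivative_iff_has_vector_derivative)
    qed (use s(1,3) G in \<open>auto intro!: continuous_intros\<close>)
    moreover have "(\<lambda>x. G x / x\<^sup>2) integrable_on {s..1}"
      using s G by (intro integrable_continuous_interval) (auto intro!: continuous_intros)
    ultimately have "(\<lambda>x. (ln \<bar>1 - x * r\<bar> / x - G x / x\<^sup>2) + G x / x\<^sup>2) integrable_on {s..1}"
      by (intro integrable_add) (auto simp: has_integral_integrable)
    thus ?thesis by (simp add: a_def [abs_def])
  qed

  have "a integrable_on {0..1}"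
    by (rule Henstock_Kurzweil_Integration.integrable_combine[OF _ s(3) a1 a2]) (use s(1) in linarith)
  then obtain A where A: "(a has_integral A) {0..1}" by blast

  have "(b has_integral 0 + pi * ln r) {0..1}"
  proof (rule Henstock_Kurzweil_Integration.has_integral_combine[where a = 0 and c = "1 / r" and b = 1])
    show "(b has_integral 0) {0..1 / r}"
      by (rule has_integral_is_0) (auto simp: b_def)
    have "((\<lambda>x. pi / x) has_integral (pi * ln 1 - pi * ln (1 / r))) {1 / r..1}"
    proof (rule fundamental_theorem_of_calculus)
      fix x assume "x \<in> {1 / r..1}"
      hence "x > 0" using s by (auto intro: less_le_trans)
      hence "((\<lambda>x. pi * ln x) has_real_derivative pi / x) (at x)"
        by (auto intro!: derivative_eq_intros)
      thus "((\<lambda>x. pi * ln x) has_vector_derivative pi / x) (at x within {1 / r..1})"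
        by (simp add: has_real_derivative_iff_has_vector_derivative has_vector_derivative_at_within)
    qed (use s in auto)
    hence "((\<lambda>x. pi / x) has_integral pi * ln r) {1 / r..1}"
      using r by (simp add: ln_div)
    thus "(b has_integral pi * ln r) {1 / r..1}"
      by (rule has_integral_spike_finite[where S = "{1 / r}", rotated 2]) (auto simp: b_def)
  qed (use s in auto)
  hence B: "(b has_integral pi * ln r) {0..1}" by simp

  have I: "((\<lambda>x. complex_of_real (a x) + \<i> * complex_of_real (b x)) has_integral
           complex_of_real A + \<i> * complex_of_real (pi * ln r)) {0..1}"
    by (intro has_integral_add has_integral_mult_right has_integral_of_real A B)
  have eq: "Ln (1 - linepath 0 (of_real r) x) / linepath 0 (of_real r) x * (of_real r - 0) =
      complex_of_real (a x) + \<i> * complex_of_real (b x)"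
    if x: "x \<in> {0..1} - {1 / r}" for x
  proof -
    have xr: "x * r \<noteq> 1" using x r by (auto simp: field_simps)
    have l: "linepath 0 (complex_of_real r) x = of_real (x * r)"
      by (simp add: linepath_def scaleR_conv_of_real)
    have "Ln (complex_of_real (1 - x * r)) = of_real (ln \<bar>1 - x * r\<bar>) + \<i> * (if x * r \<le> 1 then 0 else pi)"
    proof -
      consider "x * r < 1" | "x * r > 1" using xr by linarith
      thus ?thesis
      proof cases
        case 1
        hence "Ln (complex_of_real (1 - x * r)) = of_real (ln (1 - x * r))"
          by (intro Ln_of_real) auto
        thus ?thesis using 1 by simp
      next
        case 2
        have "Ln (complex_of_real (1 - x * r)) = Ln (- complex_of_real (x * r - 1))" by simp
        also have "\<dots> = Ln (complex_of_real (x * r - 1)) + \<i> * pi"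
          using 2 by (subst Ln_minus) (auto simp del: of_real_diff of_real_mult)
        also have "Ln (complex_of_real (x * r - 1)) = of_real (ln (x * r - 1))"
          using 2 by (intro Ln_of_real) auto
        finally show ?thesis using 2 by simp
      qed
    qed
    hence E: "Ln (1 - linepath 0 (of_real r) x) =
        of_real (ln \<bar>1 - x * r\<bar>) + \<i> * (if x * r \<le> 1 then 0 else pi)"
      unfolding l by simp
    have "x \<le> 1 / r \<longleftrightarrow> x * r \<le> 1" using r by (simp add: field_simps)
    thus ?thesis using r unfolding E unfolding l by (cases "x = 0") (auto simp: a_def b_def field_simps)
  qed
  have "((\<lambda>t. Ln (1 - t) / t) has_contour_integral
      of_real A + \<i> * of_real (pi * ln r)) (linepath 0 (of_real r))"
    unfolding has_contour_integral_linepath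
    by (rule has_integral_spike_finite[where S = "{1 / r}", OF _ eq I]) simp_all
  hence "contour_integral (linepath 0 (of_real r)) (\<lambda>t. Ln (1 - t) / t) =
      of_real A + \<i> * of_real (pi * ln r)"
    by (rule contour_integral_unique)
  moreover have "Arg (1 - complex_of_real r) = pi"
    using r Arg_eq_pi[of "1 - complex_of_real r"] by (simp add: complex_eq_iff)
  ultimately show ?thesis
    using r by (simp add: bloch_wigner_def)
qed

end

(*
  Seen from the vertex p_i, the edge relations say that X (p_i) records the affine ratios of four
  points of the complex plane labelled by the other vertices. The five-term relation for these
  four points and infinity turns the four terms of the volume sum based at p_i into +D(c_i) or
  -D(c_i), where c_i is their cross-ratio. The face relations express c_1, c_2, c_3 through
  x = c_5 and y = c_4 just as if the c_i were the cross-ratios of the 4-subsets of five points on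
  a conic, so the sum of the five remaining terms is again a five-term relation, now at (x, y).

  The five-term relation itself follows by differentiation: away from 0 and 1,
  dD(z) = log|z| d arg(1 - z) - log|1 - z| d arg z, so the derivative of the five-term sum cancels
  identically, and D vanishes on real arguments.
*)
theory Submission
  imports Defs
begin

section \<open>Derivative of the Bloch-Wigner function off the cut\<close>

lemma has_derivative_ln_cmod:
  assumes "z \<noteq> 0"
  shows "((\<lambda>z. ln (cmod z)) has_derivative (\<lambda>h. Re (h / z))) (at z)"
proof -
  have n: "(cmod has_derivative (\<lambda>h. h \<bullet> sgn z)) (at z)"
    using has_derivative_norm[OF assms] by simp
  have "((\<lambda>z. ln (cmod z)) has_derivative (\<lambda>h. (h \<bullet> sgn z) * inverse (cmod z))) (at z)"
    using has_derivative_ln[OF _ n] assms by simp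
  moreover have "(h \<bullet> sgn z) * inverse (cmod z) = Re (h / z)" for h
    using assms
    by (simp add: inner_complex_def sgn_div_norm Re_divide cmod_power2 [symmetric] divide_simps)
       (simp add: power2_eq_square algebra_simps)
  ultimately show ?thesis by simp
qed

text \<open>The plane cut along the real ray from 1 is starlike about 0, and the singularity of the
  integrand at 0 is removable. Hence a holomorphic primitive exists, and the segment integral can be
  differentiated in its endpoint.\<close>

lemma dilog_primitive:
  obtains F where
    "\<And>z. 1 - z \<notin> \<real>\<^sub>\<le>\<^sub>0 \<Longrightarrow> F z = contour_integral (linepath 0 z) (\<lambda>t. Ln (1 - t) / t)"
    "\<And>z. 1 - z \<notin> \<real>\<^sub>\<le>\<^sub>0 \<Longrightarrow> z \<noteq> 0 \<Longrightarrow> (F has_field_derivative Ln (1 - z) / z) (at z)"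
proof -
  define S where "S = {z::complex. 1 - z \<notin> \<real>\<^sub>\<le>\<^sub>0}"
  \<comment> \<open>The value -1 is the derivative of \<open>Ln (1 - t)\<close> at 0. The bare
    quotient is 0 there by the convention for division by zero, but one point does not affect the
    integral.\<close>
  define f where "f t = (if t = 0 then -1 else Ln (1 - t) / t)" for t :: complex
  have S_open: "open S"
  proof -
    have "S = (\<lambda>z. 1 - z) -` (- \<real>\<^sub>\<le>\<^sub>0)" by (auto simp: S_def)
    thus ?thesis by (auto intro!: open_vimage continuous_intros)
  qed
  have seg: "closed_segment 0 z \<subseteq> S" if z: "z \<in> S" for z
  proof
    fix w assume "w \<in> closed_segment 0 z"
    then obtain t where t: "0 \<le> t" "t \<le> 1" "w = of_real t * z"
      by (auto simp: in_segment scaleR_conv_of_real)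
    show "w \<in> S"
    proof (rule ccontr)
      assume "w \<notin> S"
      hence w: "t * Re z \<ge> 1" "t * Im z = 0"
        by (auto simp: S_def complex_nonpos_Reals_iff t(3))
      have "t \<noteq> 0" using w by auto
      have "Re z > 0" using w t by (smt (verit) mult_nonneg_nonpos)
      hence "t * Re z \<le> 1 * Re z" using t by (intro mult_right_mono) auto
      hence "Re z \<ge> 1" "Im z = 0" using w \<open>t \<noteq> 0\<close> by auto
      thus False using z by (auto simp: S_def complex_nonpos_Reals_iff)
    qed
  qed
  have "0 \<in> S" by (simp add: S_def)
  hence star: "starlike S" using seg by (auto simp: starlike_def)
  have der: "(f has_field_derivative ((- inverse (1 - x)) * x - Ln (1 - x)) / x^2) (at x)"
    if "x \<in> S - {0}" for x
  proof -
    have "((\<lambda>t. Ln (1 - t) / t) has_field_derivative ((- inverse (1 - x)) * x - Ln (1 - x)) / x^2) (at x)"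
      using that by (auto intro!: derivative_eq_intros simp: S_def power2_eq_square)
    thus ?thesis
      by (rule has_field_derivative_transform_within_open[of _ _ _ "- {0}"]) (use that in \<open>auto simp: f_def\<close>)
  qed
  have cont: "continuous_on S f"
    unfolding continuous_on_eq_continuous_at[OF S_open]
  proof
    fix x assume x: "x \<in> S"
    show "isCont f x"
    proof (cases "x = 0")
      case True
      have "((\<lambda>t. Ln (1 - t)) has_field_derivative -1) (at 0)"
        by (auto intro!: derivative_eq_intros)
      hence "((\<lambda>t. Ln (1 - t) / t) \<longlongrightarrow> -1) (at 0)"
        by (simp add: has_field_derivative_iff)
      hence "(f \<longlongrightarrow> -1) (at 0)"
        by (rule Lim_transform_eventually) (auto simp: eventually_at_filter f_def)
      thus ?thesis by (simp add: True isCont_def f_def)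
    next
      case False
      thus ?thesis using der[of x] x DERIV_isCont by blast
    qed
  qed
  \<comment> \<open>The exceptional set \<open>{0}\<close> is where \<open>f\<close> has only been
    shown to be continuous.\<close>
  obtain g where g: "\<And>x. x \<in> S \<Longrightarrow> (g has_field_derivative f x) (at x)"
    using holomorphic_starlike_primitive[OF cont star S_open, of "{0}"] der
    by (metis field_differentiable_def finite.emptyI finite.insertI)
  show thesis
  proof
    fix z :: complex assume z: "1 - z \<notin> \<real>\<^sub>\<le>\<^sub>0"
    hence zS: "z \<in> S" by (simp add: S_def)
    have "(f has_contour_integral (g (pathfinish (linepath 0 z)) - g (pathstart (linepath 0 z)))) (linepath 0 z)"
      by (rule contour_integral_primitive[where S = S])
         (use g seg[OF zS] in \<open>auto simp del: linepath_0 intro: has_field_derivative_at_within\<close>)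
    hence I: "((\<lambda>x. f (linepath 0 z x) * z) has_integral (g z - g 0)) {0..1}"
      by (simp add: has_contour_integral_linepath)
    have "((\<lambda>x. Ln (1 - linepath 0 z x) / linepath 0 z x * z) has_integral (g z - g 0)) {0..1}"
      by (rule has_integral_spike_finite[of "{0}", OF _ _ I]) (auto simp: f_def linepath_def)
    thus "g z - g 0 = contour_integral (linepath 0 z) (\<lambda>t. Ln (1 - t) / t)"
      by (intro contour_integral_unique[symmetric]) (simp add: has_contour_integral_linepath)
  next
    fix z :: complex assume z: "1 - z \<notin> \<real>\<^sub>\<le>\<^sub>0" "z \<noteq> 0"
    show "((\<lambda>z. g z - g 0) has_field_derivative Ln (1 - z) / z) (at z)"
      using g[of z] z by (auto intro!: derivative_eq_intros simp: S_def f_def)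
  qed
qed

text \<open>The imaginary parts are the differentials of arg(1 - z) and arg z applied to
  \<open>h\<close>. Unlike the arguments they are single-valued, so the expression involves no
  branch.\<close>

definition bloch_wigner_deriv :: "complex \<Rightarrow> complex \<Rightarrow> real" where
  "bloch_wigner_deriv z h = ln (cmod z) * Im (- h / (1 - z)) - ln (cmod (1 - z)) * Im (h / z)"

text \<open>Both the product rule and the integral contribute Arg(1 - z) Re(h / z), with opposite
  signs. The branch-dependent terms therefore cancel.\<close>

lemma has_derivative_bloch_wigner_slit:
  assumes "1 - z \<notin> \<real>\<^sub>\<le>\<^sub>0" "z \<noteq> 0"
  shows "(bloch_wigner has_derivative bloch_wigner_deriv z) (at z)"
proof -
  obtain F where F:
    "\<And>z. 1 - z \<notin> \<real>\<^sub>\<le>\<^sub>0 \<Longrightarrow> F z = contour_integral (linepath 0 z) (\<lambda>t. Ln (1 - t) / t)"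
    "\<And>z. 1 - z \<notin> \<real>\<^sub>\<le>\<^sub>0 \<Longrightarrow> z \<noteq> 0 \<Longrightarrow> (F has_field_derivative Ln (1 - z) / z) (at z)"
    using dilog_primitive by blast
  have F': "(F has_derivative (\<lambda>h. Ln (1 - z) / z * h)) (at z)"
    using F(2)[OF assms] by (simp only: has_field_derivative_def)
  have "((\<lambda>z. Ln (1 - z)) has_field_derivative (- inverse (1 - z))) (at z)"
    using assms by (auto intro!: derivative_eq_intros)
  hence L: "((\<lambda>z. Ln (1 - z)) has_derivative (\<lambda>h. (- inverse (1 - z)) * h)) (at z)"
    by (simp only: has_field_derivative_def)
  let ?f = "\<lambda>z. ln (cmod z) * Im (Ln (1 - z)) - Im (F z)"
  have "(?f has_derivative (\<lambda>h. ln (cmod z) * Im ((- inverse (1 - z)) * h) + Re (h / z) * Im (Ln (1 - z))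
      - Im (Ln (1 - z) / z * h))) (at z)"
    by (intro has_derivative_diff has_derivative_mult has_derivative_Im L F' has_derivative_ln_cmod assms)
  moreover have "ln (cmod z) * Im ((- inverse (1 - z)) * h) + Re (h / z) * Im (Ln (1 - z))
      - Im (Ln (1 - z) / z * h) = bloch_wigner_deriv z h" for h
  proof -
    have nz: "1 - z \<noteq> 0" using assms by auto
    have "Ln (1 - z) / z * h = Ln (1 - z) * (h / z)" by simp
    hence "Im (Ln (1 - z) / z * h) = ln (cmod (1 - z)) * Im (h / z) + Im (Ln (1 - z)) * Re (h / z)"
      by (simp only: times_complex.sel Re_Ln[OF nz])
    moreover have "- inverse (1 - z) * h = - h / (1 - z)" by (simp add: divide_inverse mult.commute)
    ultimately show ?thesis by (simp add: bloch_wigner_deriv_def)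
  qed
  ultimately have D: "(?f has_derivative bloch_wigner_deriv z) (at z)" by (simp only: ext)
  have op: "open ((\<lambda>z::complex. 1 - z) -` (- \<real>\<^sub>\<le>\<^sub>0))"
    by (auto intro!: open_vimage continuous_intros)
  show ?thesis
  proof (rule has_derivative_transform_within_open[OF D op])
    show "?f x = bloch_wigner x" if "x \<in> (\<lambda>z. 1 - z) -` (- \<real>\<^sub>\<le>\<^sub>0)" for x
    proof -
      have "1 - x \<noteq> 0" "1 - x \<notin> \<real>\<^sub>\<le>\<^sub>0" using that by auto
      thus ?thesis by (simp add: bloch_wigner_def F Arg_eq_Im_Ln)
    qed
  qed (use assms in auto)
qed

text \<open>For \<open>r \<le> 1\<close> the integrand is real along the segment and
  \<open>Arg (1 - r)\<close> is 0; for \<open>r > 1\<close> the two terms of the definition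
  cancel.\<close>

lemma bloch_wigner_of_real: "bloch_wigner (of_real r) = 0"
proof (cases "r > 1")
  case True
  thus ?thesis by (rule bloch_wigner_of_real_gt_1)
next
  case False
  define f where "f = (\<lambda>x. Ln (1 - linepath 0 (complex_of_real r) x) / linepath 0 (of_real r) x * of_real r)"
  \<comment> \<open>The endpoint is left out because for \<open>r = 1\<close> it is the branch
    point.\<close>
  have real: "Im (f x) = 0" if x: "x \<in> {0..1} - {1}" for x
  proof -
    have "x * r \<le> x * 1" using False x by (intro mult_left_mono) auto
    hence xr: "0 < 1 - x * r" using x by auto
    have "1 - linepath 0 (complex_of_real r) x = of_real (1 - x * r)"
      by (simp add: linepath_def scaleR_conv_of_real)
    moreover have "Ln (of_real (1 - x * r)) = of_real (ln (1 - x * r))"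
      using xr by (rule Ln_of_real)
    ultimately have "f x = of_real (ln (1 - x * r) / (x * r) * r)"
      by (simp add: f_def linepath_def scaleR_conv_of_real)
    thus ?thesis by (simp only: Im_complex_of_real)
  qed
  have "Im (integral {0..1} f) = 0"
  \<comment> \<open>A non-integrable function has integral 0 by convention, so both cases give
    imaginary part 0.\<close>
  proof (cases "f integrable_on {0..1}")
    case True
    hence "((\<lambda>x. Im (f x)) has_integral Im (integral {0..1} f)) {0..1}"
      using has_integral_linear[OF integrable_integral bounded_linear_Im] by (simp add: o_def)
    moreover have "((\<lambda>x. Im (f x)) has_integral 0) {0..1}"
      by (rule has_integral_spike_finite[of "{1}" _ _ "\<lambda>_. 0"]) (use real in auto)
    ultimately show ?thesis by (rule has_integral_unique)
  qed (simp add: not_integrable_integral)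
  hence "Im (contour_integral (linepath 0 (of_real r)) (\<lambda>t. Ln (1 - t) / t)) = 0"
    by (simp add: contour_integral_integral f_def)
  moreover have "Arg (1 - complex_of_real r) = 0"
    using False Arg_of_real[of "1 - r"] by simp
  ultimately show ?thesis by (simp add: bloch_wigner_def)
qed

section \<open>Inversion, the derivative on the cut, and reflection\<close>

text \<open>Infinitesimal form of D(1/z) = -D(z): \<open>- h / z\<^sup>2\<close> is the image of
  \<open>h\<close> under the derivative of inversion, and the extra terms log|z| d arg z
  cancel.\<close>

lemma bloch_wigner_deriv_inverse:
  assumes "z \<noteq> 0" "z \<noteq> 1"
  shows "bloch_wigner_deriv (1 / z) (- h / z\<^sup>2) = - bloch_wigner_deriv z h"
proof -
  have nz: "z \<noteq> 0" "1 - z \<noteq> 0" using assms by auto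
  have 1: "- (- h / z\<^sup>2) / (1 - 1 / z) = - (h / (1 - z)) - h / z"
    using nz assms by (simp add: divide_simps power2_eq_square) (simp add: algebra_simps)?
  have 2: "- h / z\<^sup>2 / (1 / z) = - (h / z)"
    using nz by (simp add: divide_simps power2_eq_square)
  have 3: "cmod (1 - 1 / z) = cmod (1 - z) / cmod z"
    using nz by (metis diff_divide_distrib divide_self norm_divide norm_minus_commute)
  show ?thesis
    unfolding bloch_wigner_deriv_def 1 2 3
    using nz by (simp add: ln_div norm_divide algebra_simps)
qed

lemma bloch_wigner_inverse: "bloch_wigner (1 / z) = - bloch_wigner z"
proof (cases "z \<in> \<real>")
  case True
  then obtain r where "z = of_real r" by (auto elim: Reals_cases)
  thus ?thesis
    using bloch_wigner_of_real[of r] bloch_wigner_of_real[of "1 / r"] by simp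
next
  case False
  \<comment> \<open>Off the nonnegative reals both \<open>x\<close> and \<open>1 / x\<close> avoid
    the cut, where the derivative is not yet known. The negative reals keep this region starlike
    about -1, a point fixed by inversion at which D vanishes.\<close>
  define S where "S = {z::complex. z \<notin> \<real>\<^sub>\<ge>\<^sub>0}"
  have S_open: "open S"
  proof -
    have "S = - \<real>\<^sub>\<ge>\<^sub>0" by (auto simp: S_def)
    thus ?thesis by auto
  qed
  have "closed_segment (-1) z \<subseteq> S" if z: "z \<in> S" for z
  proof
    fix w assume "w \<in> closed_segment (-1) z"
    then obtain t where t: "0 \<le> t" "t \<le> 1" "w = (1 - of_real t) * (-1) + of_real t * z"
      by (auto simp: in_segment scaleR_conv_of_real)
    show "w \<in> S"
    proof (rule ccontr)
      assume "w \<notin> S"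
      hence w: "t * Re z + t - 1 \<ge> 0" "t * Im z = 0"
        by (auto simp: S_def complex_nonneg_Reals_iff t(3) algebra_simps)
      have "t \<noteq> 0" using w by auto
      hence "Re z \<ge> 0" "Im z = 0" using w t by (smt (verit) mult_nonneg_nonpos mult_pos_neg, simp)
      thus False using z by (auto simp: S_def complex_nonneg_Reals_iff)
    qed
  qed
  moreover have m1: "-1 \<in> S" by (simp add: S_def complex_nonneg_Reals_iff)
  ultimately have "starlike S" by (auto simp: starlike_def)
  hence conn: "connected S" by (rule starlike_imp_connected)
  have "z \<in> S" using False by (auto simp: S_def complex_is_Real_iff complex_nonneg_Reals_iff)
  have "bloch_wigner (1 / z) + bloch_wigner z = bloch_wigner (1 / (-1)) + bloch_wigner (-1)"
  proof (rule has_derivative_zero_unique_connected[OF S_open conn _ \<open>z \<in> S\<close> m1])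
    fix x assume x: "x \<in> S"
    hence nz: "x \<noteq> 0" "x \<noteq> 1" by (auto simp: S_def)
    have s1: "1 - x \<notin> \<real>\<^sub>\<le>\<^sub>0"
      using x by (auto simp: S_def complex_nonneg_Reals_iff complex_nonpos_Reals_iff)
    have s2: "1 - 1 / x \<notin> \<real>\<^sub>\<le>\<^sub>0"
    proof
      assume "1 - 1 / x \<in> \<real>\<^sub>\<le>\<^sub>0"
      then obtain r where r: "1 - 1 / x = of_real r" "r \<le> 0"
        by (auto elim: nonpos_Reals_cases)
      hence "x = of_real (1 / (1 - r))"
        using nz by (auto simp: field_simps)
      thus False using x r by (auto simp: S_def simp del: of_real_divide)
    qed
    have inv: "((\<lambda>x. 1 / x) has_derivative (\<lambda>h. - h / x\<^sup>2)) (at x)"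
      using nz by (auto intro!: derivative_eq_intros simp: field_simps power2_eq_square)
    have "((\<lambda>x. bloch_wigner (1 / x) + bloch_wigner x) has_derivative
       (\<lambda>h. bloch_wigner_deriv (1 / x) (- h / x\<^sup>2) + bloch_wigner_deriv x h)) (at x)"
      using nz
      by (intro has_derivative_add has_derivative_bloch_wigner_slit s1
            has_derivative_compose[OF inv has_derivative_bloch_wigner_slit] s2) auto
    thus "((\<lambda>x. bloch_wigner (1 / x) + bloch_wigner x) has_derivative (\<lambda>h. 0)) (at x)"
      unfolding bloch_wigner_deriv_inverse[OF nz] by simp
  qed
  also have "\<dots> = 0" using bloch_wigner_of_real[of "-1"] by simp
  finally show ?thesis by simp
qed

text \<open>Inversion carries the part of the cut beyond 1 into the interval from 0 to 1, where D is
  already differentiable. Near such a point D is therefore differentiated as -D(1/z).\<close>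

lemma has_derivative_bloch_wigner:
  assumes "z \<noteq> 0" "z \<noteq> 1"
  shows "(bloch_wigner has_derivative bloch_wigner_deriv z) (at z)"
proof (cases "1 - z \<in> \<real>\<^sub>\<le>\<^sub>0")
  case False
  thus ?thesis using assms by (intro has_derivative_bloch_wigner_slit)
next
  case True
  have s: "1 - 1 / z \<notin> \<real>\<^sub>\<le>\<^sub>0"
  proof
    assume "1 - 1 / z \<in> \<real>\<^sub>\<le>\<^sub>0"
    then obtain r where r: "1 - 1 / z = of_real r" "r \<le> 0"
      by (auto elim: nonpos_Reals_cases)
    hence "z = of_real (1 / (1 - r))"
      using assms by (auto simp: field_simps)
    hence "1 - z = of_real (1 - 1 / (1 - r))" by simp
    hence "1 - 1 / (1 - r) \<le> 0" using True by (simp only: nonpos_Reals_of_real_iff)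
    moreover have "r \<noteq> 0" using r(1) assms by auto
    ultimately show False using r by (simp add: field_simps)
  qed
  have inv: "((\<lambda>x. 1 / x) has_derivative (\<lambda>h. - h / z\<^sup>2)) (at z)"
    using assms by (auto intro!: derivative_eq_intros simp: field_simps power2_eq_square)
  have "((\<lambda>x. - bloch_wigner (1 / x)) has_derivative
      (\<lambda>h. - bloch_wigner_deriv (1 / z) (- h / z\<^sup>2))) (at z)"
    using assms
    by (intro has_derivative_minus has_derivative_compose[OF inv has_derivative_bloch_wigner_slit] s) auto
  thus ?thesis
    unfolding bloch_wigner_deriv_inverse[OF assms] bloch_wigner_inverse minus_minus .
qed

text \<open>The arguments \<open>u\<close> and \<open>v\<close> are the logarithmic derivatives of \<open>g\<close> and \<open>1 - g\<close>.\<close>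

lemma has_derivative_bloch_wigner_compose:
  assumes g: "(g has_field_derivative g') (at x)" and "g x \<noteq> 0" "g x \<noteq> 1"
    and u: "g' = u * g x" and v: "- g' = v * (1 - g x)"
  shows "((\<lambda>x. bloch_wigner (g x)) has_derivative
    (\<lambda>h. ln (cmod (g x)) * Im (v * h) - ln (cmod (1 - g x)) * Im (u * h))) (at x)"
proof -
  have nz: "1 - g x \<noteq> 0" using assms by auto
  have v: "- (g' * h) / (1 - g x) = v * h" and u: "g' * h / g x = u * h" for h
    using assms nz by (simp_all add: field_simps)
  have "(g has_derivative (\<lambda>h. g' * h)) (at x)" using g by (simp add: has_field_derivative_def)
  from has_derivative_compose[OF this has_derivative_bloch_wigner[OF assms(2,3)]]
  show ?thesis unfolding bloch_wigner_deriv_def u v .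
qed

lemma connected_Compl_finite_complex: "finite T \<Longrightarrow> connected (- T :: complex set)"
  using connected_open_delete_finite[of "UNIV :: complex set" T] by (simp add: Compl_eq_Diff_UNIV connected_UNIV)

text \<open>Substituting 1 - z exchanges the two terms of dD, so the sum of both values is constant
  on the connected twice-punctured plane. It is 0 at the real point -1.\<close>

lemma bloch_wigner_one_minus: "bloch_wigner (1 - z) = - bloch_wigner z"
proof (cases "z = 0 \<or> z = 1")
  case True
  thus ?thesis using bloch_wigner_of_real[of 0] bloch_wigner_of_real[of 1] by auto
next
  case False
  hence z: "z \<in> - {0, 1}" by auto
  have "bloch_wigner (1 - z) + bloch_wigner z = bloch_wigner (1 - (-1)) + bloch_wigner (-1)"
  proof (rule has_derivative_zero_unique_connected[of "- {0, 1}", OF _ _ _ z])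
    fix x :: complex assume x: "x \<in> - {0, 1}"
    hence nz: "x \<noteq> 0" "1 - x \<noteq> 0" "x \<noteq> 1" by auto
    have "((\<lambda>x. bloch_wigner (1 - x) + bloch_wigner x) has_derivative
       (\<lambda>h. (ln (cmod (1 - x)) * Im (1 / x * h) - ln (cmod (1 - (1 - x))) * Im (- 1 / (1 - x) * h)) +
            (ln (cmod x) * Im (- 1 / (1 - x) * h) - ln (cmod (1 - x)) * Im (1 / x * h)))) (at x)"
      by (intro has_derivative_add
            has_derivative_bloch_wigner_compose[where g = "\<lambda>x. 1 - x" and g' = "-1"]
            has_derivative_bloch_wigner_compose[where g = "\<lambda>x. x" and g' = 1])
         (use nz in \<open>auto intro!: derivative_eq_intros\<close>)
    thus "((\<lambda>x. bloch_wigner (1 - x) + bloch_wigner x) has_derivative (\<lambda>h. 0)) (at x)"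
      by simp
  qed (auto intro: connected_Compl_finite_complex)
  also have "\<dots> = 0" using bloch_wigner_of_real[of "-1"] bloch_wigner_of_real[of 2] by simp
  finally show ?thesis by simp
qed

section \<open>The five-term relation in two complex variables\<close>

text \<open>Suslin's form of the five-term relation. Each argument is a cross-ratio of four of the
  points infinity, 0, 1, \<open>x\<close>, \<open>y\<close>; the points left out are, in order,
  \<open>y\<close>, \<open>x\<close>, 1, infinity, 0.\<close>

definition five_term :: "complex \<Rightarrow> complex \<Rightarrow> real" where
  "five_term x y = bloch_wigner x - bloch_wigner y + bloch_wigner (y / x)
     - bloch_wigner ((1 - 1 / x) / (1 - 1 / y)) + bloch_wigner ((1 - x) / (1 - y))"

text \<open>Exchanging the variables inverts the three quotients. Differentiation in
  \<open>x\<close> alone thus also controls the dependence on \<open>y\<close>.\<close>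

lemma five_term_swap: "five_term y x = - five_term x y"
  using bloch_wigner_inverse[of "y / x"] bloch_wigner_inverse[of "(1 - x) / (1 - y)"]
    bloch_wigner_inverse[of "(1 - 1 / x) / (1 - 1 / y)"]
  by (simp add: five_term_def)

lemma five_term_const:
  assumes y: "y \<noteq> 0" "y \<noteq> 1" and x: "x \<notin> {0, 1, y}" and x': "x' \<notin> {0, 1, y}"
  shows "five_term x y = five_term x' y"
proof (rule has_derivative_zero_unique_connected[of "- {0, 1, y}" "\<lambda>x. five_term x y"])
  fix x :: complex assume "x \<in> - {0, 1, y}"
  hence nz: "x \<noteq> 0" "x \<noteq> 1" "x \<noteq> y" "y \<noteq> x" "x - y \<noteq> 0" "x - 1 \<noteq> 0" "1 - x \<noteq> 0"
    "y - 1 \<noteq> 0" "1 - y \<noteq> 0" "y - x \<noteq> 0" using y by auto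
  note [simp] = y nz
  define lx ly lx1 ly1 lxy where "lx = ln (cmod x)" and "ly = ln (cmod y)"
    and "lx1 = ln (cmod (1 - x))" and "ly1 = ln (cmod (1 - y))" and "lxy = ln (cmod (x - y))"
  \<comment> \<open>These are the logarithmic derivatives in \<open>x\<close> of \<open>x\<close>,
    \<open>x - 1\<close> and \<open>x - y\<close>. Every argument \<open>g\<close>, and likewise
    \<open>1 - g\<close>, is a product of powers of these factors times a constant, so its
    logarithmic derivative is an integer combination of \<open>a\<close>, \<open>b\<close>,
    \<open>c\<close>.\<close>
  define a b c where "a = 1 / x" and "b = 1 / (x - 1)" and "c = 1 / (x - y)"
  have e: "1 - y / x = (x - y) / x" "(1 - 1 / x) / (1 - 1 / y) = y * (1 - x) / (x * (1 - y))"
    "1 - (1 - 1 / x) / (1 - 1 / y) = (x - y) / (x * (1 - y))"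
    "1 - (1 - x) / (1 - y) = (x - y) / (1 - y)"
    by (simp_all add: divide_simps) (simp_all add: algebra_simps)?
  have l: "ln (cmod (y / x)) = ly - lx" "ln (cmod (1 - y / x)) = lxy - lx"
    "ln (cmod ((1 - 1 / x) / (1 - 1 / y))) = ly + lx1 - lx - ly1"
    "ln (cmod (1 - (1 - 1 / x) / (1 - 1 / y))) = lxy - lx - ly1"
    "ln (cmod ((1 - x) / (1 - y))) = lx1 - ly1"
    "ln (cmod (1 - (1 - x) / (1 - y))) = lxy - ly1"
    by (simp_all only: e(1,3,4), simp_all only: e(2))
       (simp_all add: norm_divide norm_mult ln_div ln_mult lx_def ly_def lx1_def ly1_def lxy_def)
  have 1: "((\<lambda>x. bloch_wigner x) has_derivative (\<lambda>h. lx * Im (b * h) - lx1 * Im (a * h))) (at x)"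
    unfolding lx_def lx1_def
    by (rule has_derivative_bloch_wigner_compose[where g' = 1])
       (auto simp: a_def b_def field_simps)
  have 2: "((\<lambda>x. bloch_wigner (y / x)) has_derivative
      (\<lambda>h. (ly - lx) * Im ((c - a) * h) - (lxy - lx) * Im ((- a) * h))) (at x)"
    unfolding l(1,2)[symmetric]
    by (rule has_derivative_bloch_wigner_compose[where g' = "- y / x\<^sup>2"])
       (auto simp: a_def c_def divide_simps power2_eq_square intro!: derivative_eq_intros)
  have 3: "((\<lambda>x. bloch_wigner ((1 - 1 / x) / (1 - 1 / y))) has_derivative
      (\<lambda>h. (ly + lx1 - lx - ly1) * Im ((c - a) * h) - (lxy - lx - ly1) * Im ((b - a) * h))) (at x)"
    unfolding l(3,4)[symmetric]
  proof (rule has_derivative_bloch_wigner_compose[where g' = "1 / x\<^sup>2 / (1 - 1 / y)"])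
    show "((\<lambda>x. (1 - 1 / x) / (1 - 1 / y)) has_field_derivative 1 / x\<^sup>2 / (1 - 1 / y)) (at x)"
      by (auto intro!: derivative_eq_intros simp: power2_eq_square)
    show "(1 - 1 / x) / (1 - 1 / y) \<noteq> 0" by simp
    have "1 - (1 - 1 / x) / (1 - 1 / y) \<noteq> 0" unfolding e(3) by simp
    thus "(1 - 1 / x) / (1 - 1 / y) \<noteq> 1" by simp
    have "1 / x\<^sup>2 = (b - a) * (1 - 1 / x)"
      by (simp add: a_def b_def divide_simps power2_eq_square)
    thus "1 / x\<^sup>2 / (1 - 1 / y) = (b - a) * ((1 - 1 / x) / (1 - 1 / y))" by simp
    have "c - a = y / (x * (x - y))" "1 / (1 - 1 / y) = - (y / (1 - y))"
      by (simp_all add: a_def c_def divide_simps) (simp add: algebra_simps)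
    thus "- (1 / x\<^sup>2 / (1 - 1 / y)) = (c - a) * (1 - (1 - 1 / x) / (1 - 1 / y))"
      unfolding e(3) by (simp add: power2_eq_square divide_inverse)
  qed
  have 4: "((\<lambda>x. bloch_wigner ((1 - x) / (1 - y))) has_derivative
      (\<lambda>h. (lx1 - ly1) * Im (c * h) - (lxy - ly1) * Im (b * h))) (at x)"
    unfolding l(5,6)[symmetric]
  proof (rule has_derivative_bloch_wigner_compose[where g' = "- 1 / (1 - y)"])
    show "((\<lambda>x. (1 - x) / (1 - y)) has_field_derivative - 1 / (1 - y)) (at x)"
      by (rule DERIV_cdivide) (auto intro!: derivative_eq_intros)
    show "(1 - x) / (1 - y) \<noteq> 0" by simp
    have "1 - (1 - x) / (1 - y) \<noteq> 0" unfolding e(4) by simp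
    thus "(1 - x) / (1 - y) \<noteq> 1" by simp
    have "- 1 = b * (1 - x)" by (simp add: b_def divide_simps)
    thus "- 1 / (1 - y) = b * ((1 - x) / (1 - y))" by simp
    show "- (- 1 / (1 - y)) = c * (1 - (1 - x) / (1 - y))"
      unfolding e(4) by (simp add: c_def)
  qed
  have "((\<lambda>x. five_term x y) has_derivative
     (\<lambda>h. (lx * Im (b * h) - lx1 * Im (a * h)) - 0 +
          ((ly - lx) * Im ((c - a) * h) - (lxy - lx) * Im ((- a) * h)) -
          ((ly + lx1 - lx - ly1) * Im ((c - a) * h) - (lxy - lx - ly1) * Im ((b - a) * h)) +
          ((lx1 - ly1) * Im (c * h) - (lxy - ly1) * Im (b * h)))) (at x)"
    unfolding five_term_def
    by (intro has_derivative_add has_derivative_diff has_derivative_const 1 2 3 4)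
  also have "(\<lambda>h. (lx * Im (b * h) - lx1 * Im (a * h)) - 0 +
          ((ly - lx) * Im ((c - a) * h) - (lxy - lx) * Im ((- a) * h)) -
          ((ly + lx1 - lx - ly1) * Im ((c - a) * h) - (lxy - lx - ly1) * Im ((b - a) * h)) +
          ((lx1 - ly1) * Im (c * h) - (lxy - ly1) * Im (b * h))) = (\<lambda>h. 0)"
  proof
    fix h
    have i: "Im ((u - v) * h) = Im (u * h) - Im (v * h)" "Im ((- u) * h) = - Im (u * h)" for u v
      by (simp_all add: algebra_simps)
    show "(lx * Im (b * h) - lx1 * Im (a * h)) - 0 +
          ((ly - lx) * Im ((c - a) * h) - (lxy - lx) * Im ((- a) * h)) -
          ((ly + lx1 - lx - ly1) * Im ((c - a) * h) - (lxy - lx - ly1) * Im ((b - a) * h)) +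
          ((lx1 - ly1) * Im (c * h) - (lxy - ly1) * Im (b * h)) = 0"
      \<comment> \<open>Now the claim is a polynomial identity in the five logarithms and the
        imaginary parts of \<open>a * h\<close>, \<open>b * h\<close>, \<open>c * h\<close>.\<close>
      unfolding i by algebra
  qed
  finally show "((\<lambda>x. five_term x y) has_derivative (\<lambda>h. 0)) (at x)" .
qed (use x x' in \<open>auto intro: connected_Compl_finite_complex\<close>)

text \<open>Moving first \<open>x\<close> and then \<open>y\<close> along the punctured plane makes both arguments real.\<close>

lemma bloch_wigner_five_term:
  assumes "x \<notin> {0, 1}" "y \<notin> {0, 1}" "x \<noteq> y"
  shows "five_term x y = 0"
proof -
  \<comment> \<open>\<open>y\<close> may itself be real, so \<open>r\<close> must also avoid it; the
    real line is infinite.\<close>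
  obtain r :: real where r: "of_real r \<notin> {0, 1, y}"
  proof -
    have "infinite ((of_real :: real \<Rightarrow> complex) ` UNIV)"
      by (subst finite_image_iff) (auto simp: infinite_UNIV_char_0 inj_on_def)
    hence "\<not> (of_real :: real \<Rightarrow> complex) ` UNIV \<subseteq> {0, 1, y}"
      by (meson finite.emptyI finite.insertI finite_subset)
    thus thesis using that by blast
  qed
  \<comment> \<open>Any real number other than 0, 1 and \<open>r\<close> would serve.\<close>
  define s where "s = (if r = 2 then 3 else 2 :: real)"
  have "five_term x y = five_term (of_real r) y"
    using assms r by (intro five_term_const) auto
  also have "\<dots> = - five_term y (of_real r)" by (rule five_term_swap)
  also have "five_term y (of_real r) = five_term (of_real s) (of_real r)"
    using assms r by (intro five_term_const) (auto simp: s_def)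
  also have "\<dots> = 0"
    using bloch_wigner_of_real[of r] bloch_wigner_of_real[of s] bloch_wigner_of_real[of "r / s"]
      bloch_wigner_of_real[of "(1 - 1 / s) / (1 - 1 / r)"] bloch_wigner_of_real[of "(1 - s) / (1 - r)"]
    by (simp add: five_term_def)
  finally show ?thesis by simp
qed

section \<open>Volumes and the picture seen from one vertex\<close>

text \<open>The transposition acts by inversion; the rotation acts by inversion composed with
  reflection, so its two signs cancel. Together they make D alternating in the last three
  arguments.\<close>

lemma bloch_wigner_cross_ratio_structure:
  assumes "cross_ratio_structure S X" "distinct [a, b, c, d]" "{a, b, c, d} = S"
  shows "bloch_wigner (X a b d c) = - bloch_wigner (X a b c d)"
    and "bloch_wigner (X a d b c) = bloch_wigner (X a b c d)"
proof -
  have "X a b c d = 1 / X a b d c" "X a b c d = 1 / (1 - X a d b c)"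
    using assms unfolding cross_ratio_structure_def by blast+
  thus "bloch_wigner (X a b d c) = - bloch_wigner (X a b c d)"
    "bloch_wigner (X a d b c) = bloch_wigner (X a b c d)"
    by (metis add.inverse_inverse bloch_wigner_inverse bloch_wigner_one_minus)+
qed

text \<open>Each term is brought to the form base vertex first, others in their given order. The
  sign is that of the permutation moving the base vertex to the front, which prepares the grouping
  of terms by base vertex.\<close>

lemma simplex_volume_alternating:
  assumes X: "cross_ratio_structure S X" and d: "distinct [a, b, c, d]" and S: "{a, b, c, d} = S"
  shows "simplex_volume X a b c d = bloch_wigner (X a b c d) - bloch_wigner (X b a c d)
     + bloch_wigner (X c a b d) - bloch_wigner (X d a b c)"
proof -
  have "bloch_wigner (X b a d c) = - bloch_wigner (X b a c d)"
    by (rule bloch_wigner_cross_ratio_structure[OF X]) (use d S in auto)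
  moreover have "bloch_wigner (X c d a b) = bloch_wigner (X c a b d)"
    by (rule bloch_wigner_cross_ratio_structure[OF X]) (use d S in auto)
  moreover have "bloch_wigner (X d c b a) = - bloch_wigner (X d c a b)"
    by (rule bloch_wigner_cross_ratio_structure[OF X]) (use d S in auto)
  moreover have "bloch_wigner (X d c a b) = bloch_wigner (X d a b c)"
    by (rule bloch_wigner_cross_ratio_structure[OF X]) (use d S in auto)
  ultimately show ?thesis by (simp add: simplex_volume_def)
qed

text \<open>
  The model is \<open>f u v w = (a w - a u) / (a v - a u)\<close> for an injective \<open>a :: 'b \<Rightarrow> complex\<close>;
  with \<open>f = X q\<close> this is the picture seen from the vertex \<open>q\<close>.
\<close>

definition ratio_system :: "'b set \<Rightarrow> ('b \<Rightarrow> 'b \<Rightarrow> 'b \<Rightarrow> complex) \<Rightarrow> bool" where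
  "ratio_system S f \<longleftrightarrow>
     (\<forall>u v w. {u, v, w} \<subseteq> S \<and> distinct [u, v, w] \<longrightarrow>
        f u v w \<noteq> 0 \<and> f u v w \<noteq> 1 \<and> f u v w = 1 / f u w v \<and> f u v w = 1 / (1 - f w u v)) \<and>
     (\<forall>u v w z. {u, v, w, z} \<subseteq> S \<and> distinct [u, v, w, z] \<longrightarrow> f u v w = f u v z * f u z w)"

text \<open>The cross-ratio \<open>(a l - a j) (a k - a m) / ((a k - a j) (a l - a m))\<close> of the model.\<close>

definition cross_ratio :: "('b \<Rightarrow> 'b \<Rightarrow> 'b \<Rightarrow> complex) \<Rightarrow> 'b \<Rightarrow> 'b \<Rightarrow> 'b \<Rightarrow> 'b \<Rightarrow> complex" where
  "cross_ratio f j m l k = f j k l / f m k l"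

lemma ratio_systemD:
  assumes "ratio_system S f" "{u, v, w} \<subseteq> S" "distinct [u, v, w]"
  shows "f u v w \<noteq> 0" "f u v w \<noteq> 1" "f u v w = 1 / f u w v" "f u v w = 1 / (1 - f w u v)"
  using assms(1)[unfolded ratio_system_def, THEN conjunct1, rule_format, OF conjI[OF assms(2,3)]]
  by blast+

lemma ratio_system_mult:
  assumes "ratio_system S f" "{u, v, w, z} \<subseteq> S" "distinct [u, v, w, z]"
  shows "f u v w = f u v z * f u z w"
  using assms(1)[unfolded ratio_system_def, THEN conjunct2, rule_format, OF conjI[OF assms(2,3)]] .

lemma cross_ratio_swap:
  assumes "ratio_system S f" "{j, m, l, k} \<subseteq> S" "distinct [j, m, l, k]"
  shows "cross_ratio f j m k l = 1 / cross_ratio f j m l k"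
proof -
  have "f j l k = 1 / f j k l" "f m l k = 1 / f m k l"
    using assms unfolding ratio_system_def by auto
  thus ?thesis by (simp add: cross_ratio_def)
qed

text \<open>All values of \<open>f\<close> on four labels are rational functions of two of them. The
  alternating sum is then \<open>five_term x y\<close> without the term that omits infinity, and
  that term is D of the cross-ratio of the four labels.\<close>

lemma
  assumes f: "ratio_system S f" and S: "{j, k, l, m} \<subseteq> S" and d: "distinct [j, k, l, m]"
  shows cross_ratio_neq: "cross_ratio f j k m l \<noteq> 0" "cross_ratio f j k m l \<noteq> 1"
    and cross_ratio_jl: "cross_ratio f j l m k = 1 / (1 - 1 / cross_ratio f j k m l)"
    and cross_ratio_kl: "cross_ratio f k l m j = 1 / (1 - cross_ratio f j k m l)"
    and bloch_wigner_ratio_system: "bloch_wigner (f j k l) - bloch_wigner (f j k m)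
      + bloch_wigner (f j l m) - bloch_wigner (f k l m) = bloch_wigner (cross_ratio f j k m l)"
proof -
  have r: "f u v w \<noteq> 0" "f u v w \<noteq> 1" "f u v w = 1 / f u w v" "f u v w = 1 / (1 - f w u v)"
    if "{u, v, w} \<subseteq> {j, k, l, m}" "distinct [u, v, w]" for u v w
    using ratio_systemD[OF f subset_trans[OF that(1) S] that(2)] .
  have e: "f u v w = f u v z * f u z w"
    if "{u, v, w, z} \<subseteq> {j, k, l, m}" "distinct [u, v, w, z]" for u v w z
    using ratio_system_mult[OF f subset_trans[OF that(1) S] that(2)] .
  \<comment> \<open>This normalises the model to \<open>a j = 0\<close>, \<open>a k = 1\<close>,
    \<open>a l = x\<close>, \<open>a m = y\<close>; the values derived below are those read off from
    these coordinates.\<close>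
  define x y where "x = f j k l" and "y = f j k m"
  have x: "x \<noteq> 0" "x \<noteq> 1" and y: "y \<noteq> 0" "y \<noteq> 1"
    unfolding x_def y_def using r(1,2)[of j k l] r(1,2)[of j k m] d by simp_all
  have rot: "f w u v = 1 - 1 / f u v w" if "{u, v, w} \<subseteq> {j, k, l, m}" "distinct [u, v, w]" for u v w
  proof -
    have "1 / f u v w = 1 - f w u v" by (subst r(4)[OF that]) simp
    thus ?thesis by simp
  qed
  have [simp]: "j \<noteq> k" "j \<noteq> l" "j \<noteq> m" "k \<noteq> j"
    "k \<noteq> l" "k \<noteq> m" "l \<noteq> j" "l \<noteq> k" "l \<noteq> m" "m \<noteq> j" "m \<noteq> k" "m \<noteq> l"
    using d by auto
  have jlm: "f j l m = y / x"
    using e[of j l m k] r(3)[of j l k] by (simp add: x_def y_def)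
  have jml: "f j m l = x / y"
    using r(3)[of j m l] jlm by simp
  have xy: "x \<noteq> y"
    using r(2)[of j l m] jlm x by auto
  have ljk: "f l j k = 1 - 1 / x"
    using rot[of j k l] by (simp add: x_def)
  have klj: "f k l j = 1 / (1 - x)"
    using rot[of l j k] ljk x by (simp add: field_simps)
  have mjk: "f m j k = 1 - 1 / y"
    using rot[of j k m] by (simp add: y_def)
  have kmj: "f k m j = 1 / (1 - y)"
    using rot[of m j k] mjk y by (simp add: field_simps)
  have kjm: "f k j m = 1 - y"
    using r(3)[of k j m] kmj by simp
  have klm: "f k l m = (1 - y) / (1 - x)"
    using e[of k l m j] klj kjm by simp
  have ljm: "f l j m = 1 - y / x"
    using rot[of j m l] jml by simp
  have lkj: "f l k j = x / (x - 1)"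
    using r(3)[of l k j] ljk x by (simp add: field_simps)
  have lkm: "f l k m = (x - y) / (x - 1)"
  proof -
    have "f l k m = x / (x - 1) * (1 - y / x)"
      using e[of l k m j] lkj ljm by simp
    also have "\<dots> = (x - y) / (x - 1)"
      using x by (simp add: divide_simps)
    finally show ?thesis .
  qed
  have nz: "1 - x \<noteq> 0" "1 - y \<noteq> 0" "x - y \<noteq> 0" "y - x \<noteq> 0" "x - 1 \<noteq> 0" "y - 1 \<noteq> 0"
    using x y xy by auto
  have c: "cross_ratio f j k m l = (1 - 1 / x) / (1 - 1 / y)"
    unfolding cross_ratio_def jlm klm using x y nz by (simp add: divide_simps) (simp add: algebra_simps)?
  have c': "1 - cross_ratio f j k m l = (x - y) / (x * (1 - y))"
    "1 - 1 / cross_ratio f j k m l = (x - y) / (y * (x - 1))"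
    unfolding c using x y nz by (simp_all add: divide_simps) (simp_all add: algebra_simps)?
  show "cross_ratio f j k m l \<noteq> 0"
    unfolding c using x y by simp
  show "cross_ratio f j k m l \<noteq> 1"
    using c'(1) x nz by auto
  show "cross_ratio f j l m k = 1 / (1 - 1 / cross_ratio f j k m l)"
    unfolding c' unfolding cross_ratio_def lkm using x y nz by (simp add: y_def[symmetric])
  show "cross_ratio f k l m j = 1 / (1 - cross_ratio f j k m l)"
    unfolding c' unfolding cross_ratio_def kjm ljm using x y nz by (simp add: divide_simps)
  have "five_term x y = 0" using x y xy by (intro bloch_wigner_five_term) auto
  moreover have "bloch_wigner ((1 - x) / (1 - y)) = - bloch_wigner (f k l m)"
    using bloch_wigner_inverse[of "f k l m"] by (simp add: klm)
  ultimately show "bloch_wigner (f j k l) - bloch_wigner (f j k m)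
      + bloch_wigner (f j l m) - bloch_wigner (f k l m) = bloch_wigner (cross_ratio f j k m l)"
    unfolding x_def[symmetric] y_def[symmetric] c jlm five_term_def by simp
qed

section \<open>Five points: combining the five vertex pictures\<close>

theorem theorem5p2:
  fixes p :: "nat \<Rightarrow> 'a"
    and X :: "'a \<Rightarrow> 'a \<Rightarrow> 'a \<Rightarrow> 'a \<Rightarrow> complex"
  assumes "inj_on p {1, 2, 3, 4, 5}"
    and "\<And>S. S \<subseteq> p ` {1, 2, 3, 4, 5} \<Longrightarrow> card S = 4 \<Longrightarrow> cross_ratio_structure S X"
    and "edge_compatible p X"
    and "face_compatible p X"
  shows "simplex_volume X (p 1) (p 2) (p 3) (p 4)
       - simplex_volume X (p 1) (p 2) (p 3) (p 5)
       + simplex_volume X (p 1) (p 2) (p 4) (p 5)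
       - simplex_volume X (p 1) (p 3) (p 4) (p 5)
       + simplex_volume X (p 2) (p 3) (p 4) (p 5) = 0"
proof -
  define I :: "nat set" where "I = {1, 2, 3, 4, 5}"
  define f where "f i j k l = X (p i) (p j) (p k) (p l)" for i j k l
  have p_eq: "p i = p j \<longleftrightarrow> i = j" if "i \<in> I" "j \<in> I" for i j
    using assms(1) that unfolding I_def by (rule inj_on_eq_iff)
  have str: "cross_ratio_structure {p i, p j, p k, p l} X" "distinct [p i, p j, p k, p l]"
    if "{i, j, k, l} \<subseteq> I" "distinct [i, j, k, l]" for i j k l
  proof -
    show *: "distinct [p i, p j, p k, p l]" using that by (simp add: p_eq)
    show "cross_ratio_structure {p i, p j, p k, p l} X"
      by (rule assms(2)[folded I_def]) (use that * in auto)
  qed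
  have volume: "simplex_volume X (p i) (p j) (p k) (p l) =
      bloch_wigner (f i j k l) - bloch_wigner (f j i k l) + bloch_wigner (f k i j l) - bloch_wigner (f l i j k)"
    if "{i, j, k, l} \<subseteq> I" "distinct [i, j, k, l]" for i j k l
    unfolding f_def using simplex_volume_alternating[OF str[OF that] refl] .
  have ratio: "ratio_system (I - {i}) (f i)" if i: "i \<in> I" for i
    unfolding ratio_system_def
  proof (intro conjI allI impI)
    fix u v w assume "{u, v, w} \<subseteq> I - {i} \<and> distinct [u, v, w]"
    hence *: "{i, u, v, w} \<subseteq> I" "distinct [i, u, v, w]" using i by auto
    from str[OF *] show "f i u v w \<noteq> 0" "f i u v w \<noteq> 1" "f i u v w = 1 / f i u w v"
      "f i u v w = 1 / (1 - f i w u v)"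
      unfolding cross_ratio_structure_def f_def by blast+
  next
    fix u v w z assume "{u, v, w, z} \<subseteq> I - {i} \<and> distinct [u, v, w, z]"
    hence *: "{i, u, v, w, z} \<subseteq> I" "distinct [i, u, v, w, z]" using i by auto
    \<comment> \<open>Edge compatibility speaks of index tuples exhausting all five indices, which
      five distinct ones do by counting.\<close>
    have "card {i, u, v, w, z} = card I" using *(2) by (simp add: I_def)
    hence "{i, u, v, w, z} = I" by (intro card_subset_eq *) (simp_all add: I_def)
    thus "f i u v w = f i u v z * f i u z w"
      using assms(3) unfolding edge_compatible_def f_def I_def by blast
  qed
  \<comment> \<open>Dividing one side of the face relation by the other turns it into a product of
    three cross-ratios, as seen from the corners \<open>i\<close>, \<open>l\<close>,
    \<open>k\<close> of the face, each involving the pair \<open>j\<close>, \<open>m\<close> off the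
    face.\<close>
  have face: "cross_ratio (f i) j m l k * cross_ratio (f l) j m k i * cross_ratio (f k) j m i l = 1"
    if ijklm: "{i, j, k, l, m} = I" and d: "distinct [i, j, k, l, m]" for i j k l m
  proof -
    have "f i j k l * f l j i k * f k j l i = f i m k l * f l m i k * f k m l i"
      using assms(4) ijklm unfolding face_compatible_def f_def I_def by blast
    moreover have "f u v w z \<noteq> 0" if "{u, v, w, z} \<subseteq> I" "distinct [u, v, w, z]" for u v w z
      using str[OF that] unfolding cross_ratio_structure_def f_def by blast
    hence "f i m k l \<noteq> 0" "f l m i k \<noteq> 0" "f k m l i \<noteq> 0" using d ijklm by auto
    ultimately show ?thesis by (simp add: cross_ratio_def field_simps)
  qed
  have nz: "cross_ratio (f i) j k m l \<noteq> 0" "cross_ratio (f i) j k m l \<noteq> 1"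
    if "{i, j, k, l, m} \<subseteq> I" "distinct [i, j, k, l, m]" for i j k l m
    by (rule cross_ratio_neq[OF ratio[of i]]; use that in auto)+
  define x y where "x = cross_ratio (f 5) 1 2 4 3" and "y = cross_ratio (f 4) 1 2 5 3"
  have x: "x \<noteq> 0" "x \<noteq> 1" and y: "y \<noteq> 0" "y \<noteq> 1"
    unfolding x_def y_def by (rule nz; simp add: I_def)+
  have R: "ratio_system {1, 2, 3, 4} (f 5)" "ratio_system {1, 2, 3, 5} (f 4)"
    "ratio_system {1, 2, 4, 5} (f 3)" "ratio_system {1, 3, 4, 5} (f 2)" "ratio_system {2, 3, 4, 5} (f 1)"
    using ratio[of 5] ratio[of 4] ratio[of 3] ratio[of 2] ratio[of 1] by (simp_all add: I_def insert_Diff_if)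
  \<comment> \<open>The face relations produce the factor at vertex 4 with its last two labels
    reversed.\<close>
  have swap4: "cross_ratio (f 4) 1 2 3 5 = 1 / cross_ratio (f 4) 1 2 5 3"
    "cross_ratio (f 4) 1 3 2 5 = 1 / cross_ratio (f 4) 1 3 5 2"
    "cross_ratio (f 4) 2 3 1 5 = 1 / cross_ratio (f 4) 2 3 5 1"
    by (rule cross_ratio_swap[OF R(2)]; simp)+
  have c45: "cross_ratio (f 5) 1 3 4 2 = 1 / (1 - 1 / x)" "cross_ratio (f 4) 1 3 5 2 = 1 / (1 - 1 / y)"
    "cross_ratio (f 5) 2 3 4 1 = 1 / (1 - x)" "cross_ratio (f 4) 2 3 5 1 = 1 / (1 - y)"
    unfolding x_def y_def
    by (rule cross_ratio_jl[OF R(1)] cross_ratio_jl[OF R(2)]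
             cross_ratio_kl[OF R(1)] cross_ratio_kl[OF R(2)]; simp)+
  \<comment> \<open>For each \<open>i\<close> in 3, 2, 1 the face with corners \<open>i\<close>, 4,
    5 is used: its factors at 4 and 5 are functions of \<open>y\<close> and \<open>x\<close>, which
    determines the factor at \<open>i\<close>.\<close>
  have c3: "cross_ratio (f 3) 1 2 5 4 = y / x"
  proof -
    have "cross_ratio (f 3) 1 2 5 4 * x * (1 / y) = 1"
      using face[of 3 1 4 5 2] unfolding swap4 x_def y_def by (auto simp: I_def)
    thus ?thesis using x y by (simp add: field_simps)
  qed
  have c2: "cross_ratio (f 2) 1 3 5 4 = (1 - 1 / x) / (1 - 1 / y)"
  proof -
    have "cross_ratio (f 2) 1 3 5 4 * (1 / (1 - 1 / x)) * (1 - 1 / y) = 1"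
      using face[of 2 1 4 5 3] unfolding swap4 c45 by (auto simp: I_def)
    thus ?thesis using x y by (simp add: nonzero_eq_divide_eq nonzero_divide_eq_eq)
  qed
  have c1: "cross_ratio (f 1) 2 3 5 4 = (1 - x) / (1 - y)"
  proof -
    have "cross_ratio (f 1) 2 3 5 4 * (1 / (1 - x)) * (1 - y) = 1"
      using face[of 1 2 4 5 3] unfolding swap4 c45 by (auto simp: I_def)
    thus ?thesis using x y by (simp add: nonzero_eq_divide_eq nonzero_divide_eq_eq)
  qed
  \<comment> \<open>The cross-ratio \<open>y / x\<close> at vertex 3 is never 1.\<close>
  have "x \<noteq> y" using nz(2)[of 3 1 2 4 5] c3 x by (auto simp: I_def)
  hence "five_term x y = 0" using x y by (intro bloch_wigner_five_term) auto
  \<comment> \<open>Grouped by base vertex 5, 4, 3, 2, 1, the volumes contribute D of the vertex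
    cross-ratios with signs +, -, +, -, +, exactly the terms of \<open>five_term x y\<close> in
    order.\<close>
  thus ?thesis
    using bloch_wigner_ratio_system[OF R(1), of 1 2 3 4] bloch_wigner_ratio_system[OF R(2), of 1 2 3 5]
      bloch_wigner_ratio_system[OF R(3), of 1 2 4 5] bloch_wigner_ratio_system[OF R(4), of 1 3 4 5]
      bloch_wigner_ratio_system[OF R(5), of 2 3 4 5]
    by (simp add: volume I_def c1 c2 c3 x_def[symmetric] y_def[symmetric] five_term_def del: One_nat_def)
qed

end
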